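(* Let $n\ge 2$ be an integer, let $\mathcal{G}$ be the Cuntz groupoid on $X=\{0,\dots,n-1\}^{\mathbb{N}}$, and let $G=\mathbb{Q}_n\times_\delta\mathbb{Z}$ (as defined in the context). For $(x,k,y)\in\mathcal{G}$ write $x=\lambda z$, $y=\mu z$ with $\lambda,\mu$ finite words, $z\in X$ and $k=|\lambda|-|\mu|$, and put $$c(x,k,y)=\left(s(\lambda)-\frac{s(\mu)}{n^k},\; k\right).$$ Then $c:\mathcal{G}\to G$ is a (well-defined) locally constant cocycle, i.e. $c(x,k,y)\,c(y,l,w)=c(x,k+l,w)$ for all composable pairs, and for each $(r,k)\in G$, $$c^{-1}(r,k)=\{(x,k,y) : y\in\operatorname{dom}\beta_{(r,k)} \text{ and } x=\beta_{(r,k)}(y)\},$$ where $\beta$ is the partial action of $G$ on $X$ given by $\beta_{(r,k)}(y)=\frac{y}{n^k}+r$.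
   Context: Fix an integer $n\ge2$. $\mathbb{Q}_n=\{m/n^j : m\in\mathbb{Z}, j\ge 0\}$ is the additive group of $n$-adic rationals. $G=\mathbb{Q}_n\times_\delta\mathbb{Z}$ is the set $\mathbb{Q}_n\times\mathbb{Z}$ with $$(s,j)(r,k)=\left(\frac{r}{n^j}+s,\; j+k\right),\qquad (r,k)^{-1}=(-n^kr,-k).$$ $X$ is the space of all sequences $(a_1,a_2,\dots)$ with entries in $\{0,\dots,n-1\}$, with the product topology. It is identified, via $(a_1,a_2,\dots)\leftrightarrow\sum a_i/n^i$, with the Cantor set obtained from $[0,1]$ by replacing each $n$-adic rational $r\in(0,1)$ by a pair $r^-<r^+$ with $r^-$ the immediate predecessor of $r^+$ (with the order topology): sequences with a tail of $(n-1)$'s correspond to points with superscript $-$, and sequences with a tail of $0$'s correspond to points with superscript $+$. The endpoints are not doubled: $0$ is regarded as $0^+$ and $1$ as $1^-$, and $0^-,1^+$ do not belong to $X$. The partial action $\beta$ of $G$ on $X$: $\beta_{(r,k)}(x)=\frac{x}{n^k}+r$, with domain the set of $x\in X$ for which $\frac{x}{n^k}+r\in X$; superscripts are preserved: for $x$ $n$-adic, $\beta_{(r,k)}(x^\pm)=(\frac{x}{n^k}+r)^\pm$. The Cuntz groupoid $\mathcal{G}$ is the set of all triples $(x,k,y)$ with $x,y\in X$, $k\in\mathbb{Z}$ and $x_{i+k}=y_i$ for all sufficiently large $i$, with product $(x,k,y)(y,l,w)=(x,k+l,w)$ and inverse $(x,k,y)^{-1}=(y,-k,x)$. Its topology has as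 basis the sets $Z(\lambda,\mu)=\{(\lambda z,|\lambda|-|\mu|,\mu z) : z\in X\}$, with $\lambda,\mu$ finite words in $\{0,\dots,n-1\}$. For a finite word $\lambda=(\lambda_1,\dots,\lambda_{|\lambda|})$ of length $|\lambda|$ in $\{0,\dots,n-1\}$, $s(\lambda)=\frac{\lambda_1}{n}+\dots+\frac{\lambda_{|\lambda|}}{n^{|\lambda|}}$ (and $s=0$ for the empty word). *)

theory Defs
  imports
    "HOL-Analysis.Analysis"
    "HOL-Algebra.Group"
    "HOL-Library.Omega_Words_Fun"
begin

section \<open>The semidirect product of the \<open>n\<close>-adic rationals and the integers\<close>

definition nadic :: "nat \<Rightarrow> real set" where
  "nadic n = {real_of_int m / real n ^ j | (m::int) (j::nat). True}"

definition nadic_group :: "nat \<Rightarrow> (real \<times> int) monoid" where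
  "nadic_group n =
     \<lparr>carrier = nadic n \<times> UNIV,
      mult = (\<lambda>(s, j) (r, k). (r / real n powi j + s, j + k)),
      one = (0, 0)\<rparr>"

lemma nadicI: "real_of_int m / real n ^ j \<in> nadic n"
  unfolding nadic_def by blast

lemma nadic_zero: "0 \<in> nadic n"
  using nadicI[of 0 n 0] by simp

lemma nadic_uminus:
  assumes "r \<in> nadic n"
  shows "- r \<in> nadic n"
proof -
  obtain m :: int and j where "r = real_of_int m / real n ^ j"
    using assms by (auto simp: nadic_def)
  then show ?thesis
    using nadicI[of "- m" n j] by simp
qed

lemma nadic_add:
  assumes "n > 0" "r \<in> nadic n" "s \<in> nadic n"
  shows "r + s \<in> nadic n"
proof -
  obtain m :: int and j where r: "r = real_of_int m / real n ^ j"
    using assms(2) by (auto simp: nadic_def)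
  obtain p :: int and q where s: "s = real_of_int p / real n ^ q"
    using assms(3) by (auto simp: nadic_def)
  have "r + s = real_of_int (m * int n ^ q + p * int n ^ j) / real n ^ (j + q)"
    using assms(1) by (simp add: r s field_simps power_add)
  then show ?thesis
    using nadicI by metis
qed

lemma nadic_mult_powi:
  assumes "n > 0" "r \<in> nadic n"
  shows "r * real n powi k \<in> nadic n"
proof -
  obtain m :: int and j where r: "r = real_of_int m / real n ^ j"
    using assms(2) by (auto simp: nadic_def)
  show ?thesis
  proof (cases "k \<ge> 0")
    case True
    then have "r * real n powi k = real_of_int (m * int n ^ nat k) / real n ^ j"
      by (simp add: r power_int_def)
    then show ?thesis
      using nadicI by metis
  next
    case False
    then have "r * real n powi k = real_of_int m / real n ^ (j + nat (- k))"
      by (simp add: r power_int_def power_add field_simps)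
    then show ?thesis
      using nadicI by metis
  qed
qed

lemma nadic_divide_powi:
  assumes "n > 0" "r \<in> nadic n"
  shows "r / real n powi k \<in> nadic n"
  using nadic_mult_powi[OF assms, of "- k"] by (simp add: power_int_minus divide_inverse)

lemma group_nadic_group:
  assumes "n > 0"
  shows "group (nadic_group n)"
proof (rule groupI)
  fix g assume "g \<in> carrier (nadic_group n)"
  then obtain r k where g: "g = (r, k)" "r \<in> nadic n"
    by (auto simp: nadic_group_def)
  show "\<exists>h\<in>carrier (nadic_group n). h \<otimes>\<^bsub>nadic_group n\<^esub> g = \<one>\<^bsub>nadic_group n\<^esub>"
    using assms g
    by (intro bexI[of _ "(- (real n powi k * r), - k)"])
       (auto simp: nadic_group_def power_int_minus divide_inverse mult.commute
          intro!: nadic_uminus nadic_mult_powi)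
qed (use assms in \<open>auto simp: nadic_group_def power_int_add add_divide_distrib mult.commute
       intro: nadic_zero nadic_add nadic_divide_powi\<close>)

lemma inv_nadic_group:
  assumes "n > 0" "r \<in> nadic n"
  shows "inv\<^bsub>nadic_group n\<^esub> (r, k) = (- (real n powi k * r), - k)"
proof -
  interpret group "nadic_group n"
    by (rule group_nadic_group[OF assms(1)])
  show ?thesis
    by (rule inv_equality)
       (use assms in \<open>auto simp: nadic_group_def power_int_minus divide_inverse mult.commute
          intro!: nadic_uminus nadic_mult_powi\<close>)
qed


section \<open>Sequences and the Cantor set of doubled points\<close>

text \<open>Sequences are indexed from \<open>0\<close>: \<open>a i\<close> is the entry written $a_{i+1}$ in the usual
  1-based notation.\<close>

definition cantor_seqs :: "nat \<Rightarrow> nat word set" where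
  "cantor_seqs n = {a. \<forall>i. a i < n}"

text \<open>A point of the doubled interval is a real number together with its superscript;
  numbers that are not \<open>n\<close>-adic carry none.\<close>

datatype superscript = Plain | Minus | Plus

definition cantor_points :: "nat \<Rightarrow> (real \<times> superscript) set" where
  "cantor_points n =
     {(t, Plain) | t. t \<notin> nadic n \<and> 0 \<le> t \<and> t \<le> 1} \<union>
     {(t, Minus) | t. t \<in> nadic n \<and> 0 < t \<and> t \<le> 1} \<union>
     {(t, Plus) | t. t \<in> nadic n \<and> 0 \<le> t \<and> t < 1}"

definition seq_point :: "nat \<Rightarrow> nat word \<Rightarrow> real \<times> superscript" where
  "seq_point n a =
     (\<Sum>i. real (a i) / real n ^ (i + 1),
      if \<exists>N. \<forall>i\<ge>N. a i = n - 1 then Minus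
      else if \<exists>N. \<forall>i\<ge>N. a i = 0 then Plus
      else Plain)"


section \<open>The partial action\<close>

fun point_act :: "nat \<Rightarrow> real \<times> int \<Rightarrow> real \<times> superscript \<Rightarrow> real \<times> superscript" where
  "point_act n (r, k) (t, \<sigma>) = (t / real n powi k + r, \<sigma>)"

definition beta_dom :: "nat \<Rightarrow> real \<times> int \<Rightarrow> nat word set" where
  "beta_dom n g = {x \<in> cantor_seqs n. point_act n g (seq_point n x) \<in> cantor_points n}"

text \<open>The action lives on points; it is transported to sequences along the identification
  \<^const>\<open>seq_point\<close> of \<^term>\<open>cantor_seqs n\<close> with \<^term>\<open>cantor_points n\<close>.\<close>

definition beta :: "nat \<Rightarrow> real \<times> int \<Rightarrow> nat word \<Rightarrow> nat word" where
  "beta n g x = inv_into (cantor_seqs n) (seq_point n) (point_act n g (seq_point n x))"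


section \<open>The Cuntz groupoid\<close>

definition cuntz_groupoid :: "nat \<Rightarrow> (nat word \<times> int \<times> nat word) set" where
  "cuntz_groupoid n =
     {(x, k, y). x \<in> cantor_seqs n \<and> y \<in> cantor_seqs n \<and>
        (\<exists>N. \<forall>i\<ge>N. 0 \<le> int i + k \<and> x (nat (int i + k)) = y i)}"

definition cylinder :: "nat \<Rightarrow> nat list \<Rightarrow> nat list \<Rightarrow> (nat word \<times> int \<times> nat word) set" where
  "cylinder n u v =
     {(u \<frown> z, int (length u) - int (length v), v \<frown> z) | z. z \<in> cantor_seqs n}"

definition cuntz_topology :: "nat \<Rightarrow> (nat word \<times> int \<times> nat word) topology" where
  "cuntz_topology n =
     topology_generated_by
       {cylinder n u v | u v. u \<in> lists {..<n} \<and> v \<in> lists {..<n}}"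

definition word_sum :: "nat \<Rightarrow> nat list \<Rightarrow> real" where
  "word_sum n u = (\<Sum>i<length u. real (u ! i) / real n ^ (i + 1))"

definition cocycle_value :: "nat \<Rightarrow> nat word \<times> int \<times> nat word \<Rightarrow> real \<times> int \<Rightarrow> bool" where
  "cocycle_value n = (\<lambda>(x, k, y) c.
     \<exists>u v z. u \<in> lists {..<n} \<and> v \<in> lists {..<n} \<and> z \<in> cantor_seqs n \<and>
       x = u \<frown> z \<and> y = v \<frown> z \<and> k = int (length u) - int (length v) \<and>
       c = (word_sum n u - word_sum n v / real n powi k, k))"

definition cuntz_cocycle :: "nat \<Rightarrow> nat word \<times> int \<times> nat word \<Rightarrow> real \<times> int" where
  "cuntz_cocycle n g = (THE c. cocycle_value n g c)"

end

theory Submission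
  imports Defs
begin

text \<open>
  Write \<open>v(a)\<close> for the real number with base-\<open>n\<close> digits \<open>a\<close>. Splitting the digits of
  \<open>x = uz\<close> and \<open>y = vz\<close> after the prefixes shows that the prefix expression for the cocycle is
  simply \<open>(v(x) - v(y) / n^k, k)\<close> (\<open>cocycle_value_iff\<close>): the two contributions of the common
  tail \<open>z\<close> cancel because \<open>k = |u| - |v|\<close>. Hence the value does not depend on the decomposition,
  and the cocycle identity is a telescoping sum. On a basic set \<open>Z(u, v)\<close> the prefixes, and with
  them the value, are fixed, which gives local constancy.

  For the fibres, an element \<open>(x, k, y)\<close> of the groupoid over \<open>(r, k)\<close> satisfies
  \<open>v(x) = v(y) / n^k + r\<close>, and \<open>x\<close> and \<open>y\<close> carry the same superscript since that is
  determined by the tail. As \<open>seq_point n\<close> is a bijection onto the doubled interval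
  (\<open>seq_point_bij_betw\<close>), these two conditions say exactly \<open>x = \<beta>(y)\<close>
  (\<open>beta_graph_iff\<close>). What remains is to recover from them that the tails of \<open>x\<close> and \<open>y\<close>
  agree. Multiplying by a power of \<open>n\<close> that clears the denominator of \<open>r\<close> turns
  \<open>v(x) = v(y) / n^k + r\<close> into a congruence modulo \<open>1\<close> between the values of two shifted
  sequences. The whole argument then rests on one observation, \<open>cantor_points_eqI\<close>: points of
  the doubled interval with the same superscript that differ by an integer are equal. So the shifted
  sequences represent the same point and coincide by injectivity. Injectivity is itself an instance
  of that observation: removing equally many leading digits from two expansions of the same point
  leaves numbers congruent modulo \<open>1\<close>.
\<close>

section \<open>Tails, prefixes and superscripts\<close>

definition seq_value :: "nat \<Rightarrow> nat word \<Rightarrow> real" where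
  "seq_value n a = (\<Sum>i. real (a i) / real n ^ (i + 1))"

lemma fst_seq_point: "fst (seq_point n a) = seq_value n a"
  by (simp add: seq_point_def seq_value_def)

lemma nadic_iff:
  assumes "n > 0"
  shows "r \<in> nadic n \<longleftrightarrow> (\<exists>j. real n ^ j * r \<in> \<int>)"
proof
  assume "\<exists>j. real n ^ j * r \<in> \<int>"
  then obtain j and m :: int where "real n ^ j * r = of_int m"
    by (auto elim: Ints_cases)
  then have "r = of_int m / real n ^ j"
    using assms by (simp add: field_simps)
  then show "r \<in> nadic n"
    using nadicI by metis
next
  assume "r \<in> nadic n"
  then obtain m :: int and j where "r = of_int m / real n ^ j"
    by (auto simp: nadic_def)
  then have "real n ^ j * r = of_int m"
    using assms by simp
  then show "\<exists>j. real n ^ j * r \<in> \<int>"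
    by (metis Ints_of_int)
qed

lemma Ints_power_mult_mono:
  assumes "real n ^ j * r \<in> \<int>" "j \<le> i"
  shows "real n ^ i * r \<in> \<int>"
proof -
  have "real n ^ i * r = real n ^ (i - j) * (real n ^ j * r)"
    using assms(2) by (simp flip: power_add)
  then show ?thesis
    using assms(1) by (metis Ints_mult Ints_of_nat of_nat_power)
qed

lemma suffix_cantor_seqs: "a \<in> cantor_seqs n \<Longrightarrow> suffix j a \<in> cantor_seqs n"
  by (simp add: cantor_seqs_def)

lemma prefix_cantor_seqs: "a \<in> cantor_seqs n \<Longrightarrow> prefix j a \<in> lists {..<n}"
  by (auto simp: cantor_seqs_def)

lemma conc_cantor_seqs:
  "u \<in> lists {..<n} \<Longrightarrow> a \<in> cantor_seqs n \<Longrightarrow> u \<frown> a \<in> cantor_seqs n"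
  by (auto simp: cantor_seqs_def conc_def subset_iff lists_eq_set)

lemma word_sum_Ints:
  assumes "n > 0"
  shows "real n ^ length u * word_sum n u \<in> \<int>"
proof -
  have "real n ^ length u * word_sum n u = (\<Sum>i<length u. real (u ! i * n ^ (length u - (i + 1))))"
    unfolding word_sum_def sum_distrib_left
  proof (rule sum.cong[OF refl])
    fix i assume "i \<in> {..<length u}"
    then have "length u = (i + 1) + (length u - (i + 1))"
      by simp
    then have "real n ^ length u = real n ^ (i + 1) * real n ^ (length u - (i + 1))"
      by (metis power_add)
    then show "real n ^ length u * (real (u ! i) / real n ^ (i + 1)) =
        real (u ! i * n ^ (length u - (i + 1)))"
      using assms by simp
  qed
  also have "\<dots> \<in> \<int>"
    by (intro Ints_sum Ints_of_nat)
  finally show ?thesis .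
qed

lemma word_sum_nadic: "n > 0 \<Longrightarrow> word_sum n u \<in> nadic n"
  using word_sum_Ints nadic_iff by blast

lemma tail_conc:
  "(\<exists>N. \<forall>i\<ge>N. (u \<frown> a) i = d) \<longleftrightarrow> (\<exists>N. \<forall>i\<ge>N. a i = d)"
proof
  assume "\<exists>N. \<forall>i\<ge>N. (u \<frown> a) i = d"
  then obtain N where N: "\<forall>i\<ge>N. (u \<frown> a) i = d" ..
  have "a i = d" if "i \<ge> N" for i
    using N[rule_format, of "i + length u"] that by simp
  then show "\<exists>N. \<forall>i\<ge>N. a i = d" by blast
next
  assume "\<exists>N. \<forall>i\<ge>N. a i = d"
  then obtain N where "\<forall>i\<ge>N. a i = d" ..
  then have "\<forall>i\<ge>N + length u. (u \<frown> a) i = d"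
    by simp
  then show "\<exists>N. \<forall>i\<ge>N. (u \<frown> a) i = d" ..
qed

lemma snd_seq_point_conc: "snd (seq_point n (u \<frown> a)) = snd (seq_point n a)"
  by (simp add: seq_point_def tail_conc)

lemma snd_seq_point_suffix: "snd (seq_point n (suffix j a)) = snd (seq_point n a)"
  using snd_seq_point_conc[of n "prefix j a" "suffix j a"] by simp

text \<open>Both numbers lie in \<open>[0, 1)\<close> or both in \<open>(0, 1]\<close>, depending on the superscript: the
  ambiguity between \<open>0\<close> and \<open>1\<close> modulo \<open>1\<close> is exactly what the superscript resolves.\<close>

lemma cantor_points_eqI:
  assumes "p \<in> cantor_points n" "q \<in> cantor_points n"
    and "snd p = snd q" "fst p - fst q \<in> \<int>"
  shows "p = q"
proof -
  have bounds: "0 \<le> fst p \<and> fst p \<le> 1 \<and> (snd p \<noteq> Minus \<longrightarrow> fst p < 1) \<and> (snd p \<noteq> Plus \<longrightarrow> 0 < fst p)"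
    if "p \<in> cantor_points n" for p
    using that nadicI[of 0 n 0] nadicI[of 1 n 0]
    by (auto simp: cantor_points_def order_less_le)
  have "\<bar>fst p - fst q\<bar> < 1"
    using bounds[OF assms(1)] bounds[OF assms(2)] assms(3) by (cases "snd p") auto
  with assms(4) have "fst p - fst q = 0"
    by (elim Ints_cases) simp
  then show ?thesis
    using assms(3) by (simp add: prod_eq_iff)
qed

section \<open>Values of expansions\<close>

text \<open>Complementing digits replaces \<open>t\<close> by \<open>1 - t\<close> and interchanges the two superscripts, so it
  carries every statement about tails of \<open>0\<close> over to tails of \<open>n - 1\<close>.\<close>

definition reflect :: "nat \<Rightarrow> nat word \<Rightarrow> nat word" where
  "reflect n a = (\<lambda>i. n - 1 - a i)"

context
  fixes n :: nat
  assumes n: "n \<ge> 2"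
begin

lemma n_pos: "n > 0"
  using n by simp

lemma top_digits_sums: "(\<lambda>i. real (n - 1) / real n ^ (i + 1)) sums 1"
proof -
  have "(\<lambda>i. real (n - 1) / real n * (1 / real n) ^ i) sums (real (n - 1) / real n * (1 / (1 - 1 / real n)))"
    using n by (intro sums_mult geometric_sums) simp
  also have "real (n - 1) / real n * (1 / (1 - 1 / real n)) = 1"
    using n by (simp add: field_simps of_nat_diff)
  finally show ?thesis
    by (simp add: power_divide)
qed

lemma digit_le:
  assumes "a \<in> cantor_seqs n"
  shows "real (a i) / real n ^ (i + 1) \<le> real (n - 1) / real n ^ (i + 1)"
proof -
  have "a i < n"
    using assms by (simp add: cantor_seqs_def)
  then have "a i \<le> n - 1"
    by simp
  then show ?thesis
    by (intro divide_right_mono) auto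
qed

lemma summable_digits:
  assumes "a \<in> cantor_seqs n"
  shows "summable (\<lambda>i. real (a i) / real n ^ (i + 1))"
  by (rule summable_comparison_test'[OF sums_summable[OF top_digits_sums], of 0])
     (use digit_le[OF assms] in simp)

lemma seq_value_nonneg: "a \<in> cantor_seqs n \<Longrightarrow> 0 \<le> seq_value n a"
  unfolding seq_value_def by (intro suminf_nonneg summable_digits) auto

lemma seq_value_eq_0_iff:
  assumes "a \<in> cantor_seqs n"
  shows "seq_value n a = 0 \<longleftrightarrow> (\<forall>i. a i = 0)"
  unfolding seq_value_def
  by (subst suminf_eq_zero_iff[OF summable_digits[OF assms]]) (use n in auto)

lemma seq_value_conc:
  assumes "u \<in> lists {..<n}" "a \<in> cantor_seqs n"
  shows "seq_value n (u \<frown> a) = word_sum n u + seq_value n a / real n ^ length u"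
proof -
  let ?f = "\<lambda>i. real ((u \<frown> a) i) / real n ^ (i + 1)"
  have "seq_value n (u \<frown> a) = (\<Sum>i. ?f (i + length u)) + (\<Sum>i<length u. ?f i)"
    unfolding seq_value_def
    by (intro suminf_split_initial_segment summable_digits conc_cantor_seqs assms)
  also have "(\<Sum>i<length u. ?f i) = word_sum n u"
    by (simp add: word_sum_def)
  also have "(\<Sum>i. ?f (i + length u)) = (\<Sum>i. real (a i) / real n ^ (i + 1) / real n ^ length u)"
    by (simp add: power_add mult.assoc)
  also have "\<dots> = seq_value n a / real n ^ length u"
    unfolding seq_value_def by (rule suminf_divide[OF summable_digits[OF assms(2)]])
  finally show ?thesis by simp
qed

lemma seq_value_suffix:
  assumes "a \<in> cantor_seqs n"
  shows "real n ^ j * seq_value n a - seq_value n (suffix j a) \<in> \<int>"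
proof -
  have "seq_value n a = word_sum n (prefix j a) + seq_value n (suffix j a) / real n ^ j"
    using seq_value_conc[OF prefix_cantor_seqs[OF assms, of j] suffix_cantor_seqs[OF assms, of j]]
    by simp
  then have "real n ^ j * seq_value n a - seq_value n (suffix j a) =
      real n ^ length (prefix j a) * word_sum n (prefix j a)"
    using n by (simp add: field_simps)
  then show ?thesis
    using word_sum_Ints[OF n_pos, of "prefix j a"] by simp
qed

lemma reflect_cantor_seqs: "reflect n a \<in> cantor_seqs n"
  using n by (auto simp: reflect_def cantor_seqs_def)

lemma seq_value_reflect:
  assumes "a \<in> cantor_seqs n"
  shows "seq_value n (reflect n a) = 1 - seq_value n a"
proof -
  have "(\<lambda>i. real (n - 1) / real n ^ (i + 1) - real (a i) / real n ^ (i + 1)) sums (1 - seq_value n a)"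
    unfolding seq_value_def
    by (intro sums_diff top_digits_sums summable_sums summable_digits assms)
  moreover have "real (n - 1 - a i) = real (n - 1) - real (a i)" for i
    using assms n by (intro of_nat_diff) (auto simp: cantor_seqs_def dest!: spec[of _ i])
  ultimately show ?thesis
    by (simp add: seq_value_def reflect_def sums_iff diff_divide_distrib)
qed

lemma seq_value_le_1: "a \<in> cantor_seqs n \<Longrightarrow> seq_value n a \<le> 1"
  using seq_value_nonneg[OF reflect_cantor_seqs, of a] by (simp add: seq_value_reflect)

lemma seq_value_eq_1_iff:
  assumes "a \<in> cantor_seqs n"
  shows "seq_value n a = 1 \<longleftrightarrow> (\<forall>i. a i = n - 1)"
proof -
  have "seq_value n a = 1 \<longleftrightarrow> (\<forall>i. reflect n a i = 0)"
    using seq_value_eq_0_iff[OF reflect_cantor_seqs, of a] seq_value_reflect[OF assms] by auto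
  also have "\<dots> \<longleftrightarrow> (\<forall>i. a i = n - 1)"
  proof (intro all_cong1)
    fix i
    have "a i < n"
      using assms by (simp add: cantor_seqs_def)
    then show "reflect n a i = 0 \<longleftrightarrow> a i = n - 1"
      by (auto simp: reflect_def)
  qed
  finally show ?thesis .
qed

text \<open>The value is \<open>n\<close>-adic iff some shift of the sequence has an integral value, that is \<open>0\<close> or
  \<open>1\<close>, and these two values have only the constant expansions. This is why \<open>seq_point\<close>,
  which reads the superscript off the tail, takes values in the doubled interval.\<close>

lemma seq_value_nadic_iff:
  assumes a: "a \<in> cantor_seqs n"
  shows "seq_value n a \<in> nadic n \<longleftrightarrow> (\<exists>N. \<forall>i\<ge>N. a i = n - 1) \<or> (\<exists>N. \<forall>i\<ge>N. a i = 0)"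
proof -
  have "seq_value n a \<in> nadic n \<longleftrightarrow> (\<exists>j. seq_value n (suffix j a) \<in> \<int>)"
    unfolding nadic_iff[OF n_pos]
  proof (rule ex_cong1)
    fix j
    show "real n ^ j * seq_value n a \<in> \<int> \<longleftrightarrow> seq_value n (suffix j a) \<in> \<int>"
      using seq_value_suffix[OF a, of j] Ints_add[of _ "seq_value n (suffix j a)"] Ints_diff by fastforce
  qed
  also have "\<dots> \<longleftrightarrow> (\<exists>j. seq_value n (suffix j a) = 1 \<or> seq_value n (suffix j a) = 0)"
  proof (intro ex_cong1 iffI)
    fix j assume "seq_value n (suffix j a) \<in> \<int>"
    then obtain m :: int where m: "seq_value n (suffix j a) = of_int m"
      by (elim Ints_cases)
    moreover have "0 \<le> m" "m \<le> 1"
      using seq_value_nonneg[OF suffix_cantor_seqs[OF a, of j]]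
        seq_value_le_1[OF suffix_cantor_seqs[OF a, of j]] m by simp_all
    ultimately show "seq_value n (suffix j a) = 1 \<or> seq_value n (suffix j a) = 0"
      by auto
  qed auto
  also have "\<dots> \<longleftrightarrow> (\<exists>N. \<forall>i\<ge>N. a i = n - 1) \<or> (\<exists>N. \<forall>i\<ge>N. a i = 0)"
  proof -
    have "(\<forall>i. a (j + i) = d) \<longleftrightarrow> (\<forall>i\<ge>j. a i = d)" for j d
      by (metis le_add1 le_iff_add)
    then show ?thesis
      by (simp add: seq_value_eq_0_iff seq_value_eq_1_iff suffix_cantor_seqs[OF a] ex_disj_distrib)
  qed
  finally show ?thesis .
qed

section \<open>Sequences as points of the doubled interval\<close>

lemma seq_point_in_cantor_points:
  assumes a: "a \<in> cantor_seqs n"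
  shows "seq_point n a \<in> cantor_points n"
proof -
  have pos: "0 < seq_value n a" if "\<forall>i\<ge>N. a i = n - 1" for N
  proof -
    have "a N \<noteq> 0"
      using that n by simp
    then have "seq_value n a \<noteq> 0"
      unfolding seq_value_eq_0_iff[OF a] by metis
    then show ?thesis
      using seq_value_nonneg[OF a] by simp
  qed
  have less: "seq_value n a < 1" if "\<forall>i\<ge>N. a i = 0" for N
  proof -
    have "a N \<noteq> n - 1"
      using that n by simp
    then have "seq_value n a \<noteq> 1"
      unfolding seq_value_eq_1_iff[OF a] by metis
    then show ?thesis
      using seq_value_le_1[OF a] by simp
  qed
  have "seq_point n a = (seq_value n a, snd (seq_point n a))"
    by (simp add: prod_eq_iff fst_seq_point)
  also have "\<dots> \<in> cantor_points n"
    using seq_value_nadic_iff[OF a] seq_value_nonneg[OF a] seq_value_le_1[OF a] pos less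
    by (auto simp: seq_point_def cantor_points_def)
  finally show ?thesis .
qed

lemma seq_point_eqI:
  assumes "a \<in> cantor_seqs n" "b \<in> cantor_seqs n"
    and "snd (seq_point n a) = snd (seq_point n b)"
    and "seq_value n a - seq_value n b \<in> \<int>"
  shows "seq_point n a = seq_point n b"
  using assms by (intro cantor_points_eqI[of _ n] seq_point_in_cantor_points) (auto simp: fst_seq_point)

text \<open>A congruence modulo \<open>1\<close> between multiples of two values by powers of \<open>n\<close> is a congruence between
  the values of the shifted sequences, hence an equality of points. With \<open>i = j\<close> this yields
  injectivity of the expansion, with \<open>i - j = k\<close> the equality of tails in the groupoid.\<close>

lemma seq_point_suffix_eqI:
  assumes ab: "a \<in> cantor_seqs n" "b \<in> cantor_seqs n"
    and sup: "snd (seq_point n a) = snd (seq_point n b)"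
    and int: "real n ^ i * seq_value n a - real n ^ j * seq_value n b \<in> \<int>"
  shows "seq_point n (suffix i a) = seq_point n (suffix j b)"
proof (rule seq_point_eqI)
  have "seq_value n (suffix i a) - seq_value n (suffix j b) =
      (real n ^ i * seq_value n a - real n ^ j * seq_value n b)
      - (real n ^ i * seq_value n a - seq_value n (suffix i a))
      + (real n ^ j * seq_value n b - seq_value n (suffix j b))"
    by simp
  also have "\<dots> \<in> \<int>"
    by (intro Ints_add Ints_diff int seq_value_suffix ab)
  finally show "seq_value n (suffix i a) - seq_value n (suffix j b) \<in> \<int>" .
qed (use assms in \<open>simp_all add: suffix_cantor_seqs snd_seq_point_suffix\<close>)

lemma inj_on_seq_point: "inj_on (seq_point n) (cantor_seqs n)"
proof (rule inj_onI, rule ext)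
  fix a b j
  assume ab: "a \<in> cantor_seqs n" "b \<in> cantor_seqs n" "seq_point n a = seq_point n b"
  have digit: "real (c 0) = real n * seq_value n c - seq_value n (suffix 1 c)"
    if "c \<in> cantor_seqs n" for c
    using seq_value_conc[OF prefix_cantor_seqs[OF that, of 1] suffix_cantor_seqs[OF that, of 1]] n
    by (simp add: word_sum_def field_simps)
  have val: "seq_value n a = seq_value n b"
    using ab(3) by (metis fst_seq_point)
  have suf: "seq_point n (suffix i a) = seq_point n (suffix i b)" for i
    using ab val by (intro seq_point_suffix_eqI) auto
  have "seq_value n (suffix i a) = seq_value n (suffix i b)" for i
    using suf[of i] by (metis fst_seq_point)
  then have "real (suffix j a 0) = real (suffix j b 0)"
    using ab by (simp add: digit suffix_cantor_seqs del: suffix_nth)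
  then show "a j = b j"
    by simp
qed

text \<open>The digits are the increments \<open>\<lfloor>n^(i+1) t\<rfloor> - n \<lfloor>n^i t\<rfloor>\<close> of the truncations of \<open>t\<close>. Truncation
  is exact from some point on when \<open>t\<close> is \<open>n\<close>-adic, so this expansion then ends in zeros and
  represents the point with superscript \<open>Plus\<close>.\<close>

lemma expansion_exists:
  assumes t: "0 \<le> t" "t < 1"
  shows "\<exists>a\<in>cantor_seqs n. seq_value n a = t \<and> (t \<in> nadic n \<longrightarrow> snd (seq_point n a) = Plus)"
proof -
  define d where "d i = \<lfloor>real n ^ (i + 1) * t\<rfloor> - int n * \<lfloor>real n ^ i * t\<rfloor>" for i
  define a where "a i = nat (d i)" for i
  have d: "0 \<le> d i \<and> d i < int n" for i
  proof -
    let ?y = "real n ^ i * t"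
    have "real n * real_of_int \<lfloor>?y\<rfloor> \<le> real n * ?y" "real n * ?y < real n * (real_of_int \<lfloor>?y\<rfloor> + 1)"
      using n by (auto intro: mult_left_mono)
    then have "int n * \<lfloor>?y\<rfloor> \<le> \<lfloor>real n * ?y\<rfloor>" "\<lfloor>real n * ?y\<rfloor> < int n * \<lfloor>?y\<rfloor> + int n"
      by (simp_all add: le_floor_iff floor_less_iff algebra_simps)
    then show ?thesis
      by (simp add: d_def mult.assoc)
  qed
  have a_real: "real (a i) = real_of_int (d i)" for i
    using d by (simp add: a_def)
  have a: "a \<in> cantor_seqs n"
    using d by (auto simp: cantor_seqs_def a_def nat_less_iff)
  have partial: "(\<Sum>i<N. real (a i) / real n ^ (i + 1)) = real_of_int \<lfloor>real n ^ N * t\<rfloor> / real n ^ N" for N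
  proof (induction N)
    case 0
    then show ?case using t by (simp add: floor_eq_iff)
  next
    case (Suc N)
    then show ?case using n by (simp add: a_real d_def field_simps)
  qed
  have "(\<lambda>N. real_of_int \<lfloor>real n ^ N * t\<rfloor> / real n ^ N) \<longlonglongrightarrow> t"
  proof (rule tendsto_sandwich[OF always_eventually always_eventually])
    show "\<forall>N. t - (1 / real n) ^ N \<le> real_of_int \<lfloor>real n ^ N * t\<rfloor> / real n ^ N"
    proof
      fix N
      have "real n ^ N * t - 1 \<le> real_of_int \<lfloor>real n ^ N * t\<rfloor>"
        by linarith
      then have "t * real n ^ N - 1 \<le> real_of_int \<lfloor>real n ^ N * t\<rfloor>"
        by (simp only: mult.commute)
      then have "(t * real n ^ N - 1) / real n ^ N \<le> real_of_int \<lfloor>real n ^ N * t\<rfloor> / real n ^ N"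
        by (intro divide_right_mono) simp_all
      then show "t - (1 / real n) ^ N \<le> real_of_int \<lfloor>real n ^ N * t\<rfloor> / real n ^ N"
        using n by (simp add: power_divide diff_divide_distrib)
    qed
    show "\<forall>N. real_of_int \<lfloor>real n ^ N * t\<rfloor> / real n ^ N \<le> t"
      using n by (auto simp: divide_le_eq mult.commute)
    have "(\<lambda>N. t - (1 / real n) ^ N) \<longlonglongrightarrow> t - 0"
      using n by (intro tendsto_diff tendsto_const LIMSEQ_power_zero) simp
    then show "(\<lambda>N. t - (1 / real n) ^ N) \<longlonglongrightarrow> t"
      by simp
  qed auto
  then have val: "seq_value n a = t"
    unfolding seq_value_def by (intro sums_unique[symmetric]) (simp only: sums_def partial)
  have "snd (seq_point n a) = Plus" if nadic: "t \<in> nadic n"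
  proof -
    obtain j where j: "real n ^ j * t \<in> \<int>"
      using nadic nadic_iff[OF n_pos] by blast
    have a0: "a i = 0" if i: "i \<ge> j" for i
    proof -
      obtain m :: int where m: "real n ^ i * t = of_int m"
        using Ints_power_mult_mono[OF j i] by (elim Ints_cases)
      then have "real n ^ (i + 1) * t = of_int (int n * m)"
        by (simp add: mult.assoc)
      then show ?thesis
        unfolding a_def d_def using m by (simp only: floor_of_int)
    qed
    have "\<not> (\<forall>i\<ge>N. a i = n - 1)" for N
      using a0[of "max N j"] n by (auto intro!: exI[of _ "max N j"])
    then show ?thesis
      using a0 by (auto simp: seq_point_def)
  qed
  with a val show ?thesis
    by blast
qed

lemma snd_seq_point_reflect:
  assumes a: "a \<in> cantor_seqs n" and plus: "snd (seq_point n a) = Plus"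
  shows "snd (seq_point n (reflect n a)) = Minus"
proof -
  obtain N where "\<forall>i\<ge>N. a i = 0"
    using plus by (auto simp: seq_point_def split: if_splits)
  then have "\<forall>i\<ge>N. reflect n a i = n - 1"
    by (simp add: reflect_def)
  then show ?thesis
    by (auto simp: seq_point_def)
qed

text \<open>For surjectivity, a point with superscript \<open>Minus\<close> is the reflection of one with superscript
  \<open>Plus\<close>.\<close>

lemma seq_point_bij_betw: "bij_betw (seq_point n) (cantor_seqs n) (cantor_points n)"
  unfolding bij_betw_def
proof (intro conjI inj_on_seq_point subset_antisym image_subsetI seq_point_in_cantor_points subsetI)
  fix p assume p: "p \<in> cantor_points n"
  have "\<exists>a\<in>cantor_seqs n. seq_value n a = fst p \<and> snd (seq_point n a) = snd p"
  proof (cases "snd p")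
    case Plus
    then have "0 \<le> fst p" "fst p < 1" "fst p \<in> nadic n"
      using p by (auto simp: cantor_points_def)
    then show ?thesis
      using expansion_exists[of "fst p"] Plus by auto
  next
    case Minus
    then have *: "0 \<le> 1 - fst p" "1 - fst p < 1" "fst p \<in> nadic n"
      using p by (auto simp: cantor_points_def)
    then have "1 - fst p \<in> nadic n"
      using nadic_add[OF n_pos _ nadic_uminus, of 1 "fst p"] nadicI[of 1 n 0] by simp
    then obtain a where "a \<in> cantor_seqs n" "seq_value n a = 1 - fst p" "snd (seq_point n a) = Plus"
      using expansion_exists[OF *(1,2)] by blast
    then show ?thesis
      using Minus by (intro bexI[of _ "reflect n a"])
        (simp_all add: seq_value_reflect snd_seq_point_reflect reflect_cantor_seqs)
  next
    case Plain
    then have *: "0 \<le> fst p" "fst p \<le> 1" "fst p \<notin> nadic n"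
      using p by (auto simp: cantor_points_def)
    then have "fst p < 1"
      using nadicI[of 1 n 0] by (auto simp: order_less_le)
    then obtain a where a: "a \<in> cantor_seqs n" "seq_value n a = fst p"
      using expansion_exists[OF *(1)] by blast
    then have "snd (seq_point n a) = Plain"
      using seq_value_nadic_iff[OF a(1)] *(3) by (simp add: seq_point_def)
    then show ?thesis
      using a Plain by auto
  qed
  then show "p \<in> seq_point n ` cantor_seqs n"
    by (metis fst_seq_point imageI prod_eq_iff)
qed

section \<open>The partial action and the cocycle\<close>

text \<open>The inverse map in the definition of \<open>\<beta>\<close> is eliminated, which leaves an affine relation between
  values together with equality of superscripts.\<close>

lemma beta_graph_iff:
  "y \<in> beta_dom n (r, k) \<and> x = beta n (r, k) y \<longleftrightarrow>
   x \<in> cantor_seqs n \<and> y \<in> cantor_seqs n \<and>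
   snd (seq_point n x) = snd (seq_point n y) \<and>
   seq_value n x = seq_value n y / real n powi k + r"
proof -
  have act: "point_act n (r, k) (seq_point n y) =
      (seq_value n y / real n powi k + r, snd (seq_point n y))"
    by (cases "seq_point n y") (simp flip: fst_seq_point)
  have "y \<in> beta_dom n (r, k) \<and> x = beta n (r, k) y \<longleftrightarrow>
      x \<in> cantor_seqs n \<and> y \<in> cantor_seqs n \<and> seq_point n x = point_act n (r, k) (seq_point n y)"
    using seq_point_bij_betw unfolding beta_dom_def beta_def
    by (auto simp: bij_betw_def f_inv_into_f inv_into_into) (metis imageI, metis inv_into_f_f)
  then show ?thesis
    by (auto simp: act prod_eq_iff fst_seq_point)
qed

text \<open>The form of the groupoid in which \<^const>\<open>cocycle_value\<close> and \<^const>\<open>cylinder\<close> are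
  stated: tail equivalence with lag \<open>k\<close> means having a common tail after prefixes whose lengths
  differ by \<open>k\<close>.\<close>

lemma cuntz_groupoid_iff:
  "(x, k, y) \<in> cuntz_groupoid n \<longleftrightarrow>
   (\<exists>u v z. u \<in> lists {..<n} \<and> v \<in> lists {..<n} \<and> z \<in> cantor_seqs n \<and>
      x = u \<frown> z \<and> y = v \<frown> z \<and> k = int (length u) - int (length v))"
proof
  assume "(x, k, y) \<in> cuntz_groupoid n"
  then obtain N where x: "x \<in> cantor_seqs n" and y: "y \<in> cantor_seqs n"
    and N: "\<And>i. i \<ge> N \<Longrightarrow> 0 \<le> int i + k \<and> x (nat (int i + k)) = y i"
    by (auto simp: cuntz_groupoid_def)
  define M where "M = nat (int N + k)"
  have M: "int M = int N + k"
    using N[of N] by (simp add: M_def)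
  have "suffix M x = suffix N y"
  proof
    fix i
    have "nat (int (N + i) + k) = M + i"
      using M by simp
    then show "suffix M x i = suffix N y i"
      using N[of "N + i"] by simp
  qed
  then have "x = prefix M x \<frown> suffix N y"
    by (metis prefix_suffix)
  moreover have "y = prefix N y \<frown> suffix N y"
    by (rule prefix_suffix)
  moreover have "k = int (length (prefix M x)) - int (length (prefix N y))"
    using M by simp
  ultimately show "\<exists>u v z. u \<in> lists {..<n} \<and> v \<in> lists {..<n} \<and> z \<in> cantor_seqs n \<and>
      x = u \<frown> z \<and> y = v \<frown> z \<and> k = int (length u) - int (length v)"
    using x y prefix_cantor_seqs suffix_cantor_seqs by blast
next
  assume "\<exists>u v z. u \<in> lists {..<n} \<and> v \<in> lists {..<n} \<and> z \<in> cantor_seqs n \<and>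
      x = u \<frown> z \<and> y = v \<frown> z \<and> k = int (length u) - int (length v)"
  then obtain u v z where *: "u \<in> lists {..<n}" "v \<in> lists {..<n}" "z \<in> cantor_seqs n"
      "x = u \<frown> z" "y = v \<frown> z" "k = int (length u) - int (length v)"
    by blast
  have "0 \<le> int i + k \<and> x (nat (int i + k)) = y i" if "i \<ge> length v" for i
  proof -
    have "nat (int i + k) = length u + (i - length v)"
      using that * by simp
    then show ?thesis
      using that * by simp
  qed
  then show "(x, k, y) \<in> cuntz_groupoid n"
    using * conc_cantor_seqs unfolding cuntz_groupoid_def by blast
qed

text \<open>The prefixes disappear: the tail contributes \<open>v(z) / n^|u|\<close> to \<open>v(x)\<close> and
  \<open>v(z) / n^(|v| + k)\<close> to \<open>v(y) / n^k\<close>, and \<open>|v| + k = |u|\<close>.\<close>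

lemma cocycle_value_iff:
  assumes g: "(x, k, y) \<in> cuntz_groupoid n"
  shows "cocycle_value n (x, k, y) c \<longleftrightarrow> c = (seq_value n x - seq_value n y / real n powi k, k)"
proof -
  have eq: "seq_value n (u \<frown> z) - seq_value n (v \<frown> z) / real n powi k =
      word_sum n u - word_sum n v / real n powi k"
    if "u \<in> lists {..<n}" "v \<in> lists {..<n}" "z \<in> cantor_seqs n"
      "k = int (length u) - int (length v)" for u v z
  proof -
    have "real n ^ length v * real n powi k = real n ^ length u"
      using n that(4) by (simp add: power_int_diff)
    then have "seq_value n z / real n ^ length v / real n powi k = seq_value n z / real n ^ length u"
      by (metis divide_divide_eq_left)
    then show ?thesis
      using that(1-3) by (auto simp: seq_value_conc add_divide_distrib)
  qed
  show ?thesis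
  proof
    assume "cocycle_value n (x, k, y) c"
    then obtain u v z where *: "u \<in> lists {..<n}" "v \<in> lists {..<n}" "z \<in> cantor_seqs n"
        "k = int (length u) - int (length v)" and xy: "x = u \<frown> z" "y = v \<frown> z"
      and c: "c = (word_sum n u - word_sum n v / real n powi k, k)"
      unfolding cocycle_value_def by blast
    show "c = (seq_value n x - seq_value n y / real n powi k, k)"
      unfolding c xy eq[OF *] ..
  next
    assume c: "c = (seq_value n x - seq_value n y / real n powi k, k)"
    obtain u v z where *: "u \<in> lists {..<n}" "v \<in> lists {..<n}" "z \<in> cantor_seqs n"
        "k = int (length u) - int (length v)" and xy: "x = u \<frown> z" "y = v \<frown> z"
      using g unfolding cuntz_groupoid_iff by blast
    have "c = (word_sum n u - word_sum n v / real n powi k, k)"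
      unfolding c xy eq[OF *] ..
    with * xy show "cocycle_value n (x, k, y) c"
      unfolding cocycle_value_def by blast
  qed
qed

lemma cuntz_cocycle_eq:
  assumes "(x, k, y) \<in> cuntz_groupoid n"
  shows "cuntz_cocycle n (x, k, y) = (seq_value n x - seq_value n y / real n powi k, k)"
  unfolding cuntz_cocycle_def cocycle_value_iff[OF assms] by simp

lemma cuntz_cocycle_cylinder:
  assumes uv: "u \<in> lists {..<n}" "v \<in> lists {..<n}" and g: "g \<in> cylinder n u v"
  defines "k \<equiv> int (length u) - int (length v)"
  shows "cuntz_cocycle n g = (word_sum n u - word_sum n v / real n powi k, k)"
proof -
  obtain z where z: "z \<in> cantor_seqs n" "g = (u \<frown> z, k, v \<frown> z)"
    using g by (auto simp: cylinder_def k_def)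
  have g: "(u \<frown> z, k, v \<frown> z) \<in> cuntz_groupoid n"
    using uv z by (auto simp: cuntz_groupoid_iff k_def)
  have "cocycle_value n g (word_sum n u - word_sum n v / real n powi k, k)"
    using uv z by (auto simp: cocycle_value_def k_def)
  then show ?thesis
    using cocycle_value_iff[OF g] cuntz_cocycle_eq[OF g] z(2) by simp
qed

lemma groupoid_cylinder:
  assumes "g \<in> cuntz_groupoid n"
  obtains u v where "u \<in> lists {..<n}" "v \<in> lists {..<n}" "g \<in> cylinder n u v"
  using assms by (cases g) (auto simp: cuntz_groupoid_iff cylinder_def)

lemma cuntz_groupoid_mult:
  assumes "(x, k, y) \<in> cuntz_groupoid n" "(y, l, w) \<in> cuntz_groupoid n"
  shows "(x, k + l, w) \<in> cuntz_groupoid n"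
proof -
  obtain M where M: "\<And>i. i \<ge> M \<Longrightarrow> 0 \<le> int i + k \<and> x (nat (int i + k)) = y i"
    using assms(1) by (auto simp: cuntz_groupoid_def)
  obtain N where N: "\<And>i. i \<ge> N \<Longrightarrow> 0 \<le> int i + l \<and> y (nat (int i + l)) = w i"
    using assms(2) by (auto simp: cuntz_groupoid_def)
  have "0 \<le> int i + (k + l) \<and> x (nat (int i + (k + l))) = w i" if i: "i \<ge> N + M + nat \<bar>l\<bar>" for i
  proof -
    have "nat (int i + l) \<ge> M" "int (nat (int i + l)) = int i + l"
      using i by auto
    then show ?thesis
      using M[of "nat (int i + l)"] N[of i] i by (simp add: ac_simps)
  qed
  then show ?thesis
    using assms by (auto simp: cuntz_groupoid_def)
qed

text \<open>The harder inclusion of the fibre description: an \<open>n\<close>-adic affine relation between values forces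
  the tails to agree.\<close>

lemma groupoid_if_nadic_affine:
  assumes xy: "x \<in> cantor_seqs n" "y \<in> cantor_seqs n" and r: "r \<in> nadic n"
    and sup: "snd (seq_point n x) = snd (seq_point n y)"
    and val: "seq_value n x = seq_value n y / real n powi k + r"
  shows "(x, k, y) \<in> cuntz_groupoid n"
proof -
  obtain j where j: "real n ^ j * r \<in> \<int>"
    using r nadic_iff[OF n_pos] by blast
  \<comment> \<open>Shifts that differ by \<open>k\<close>, with \<open>M\<close> large enough for \<open>n^M\<close> to clear the denominator of \<open>r\<close>.\<close>
  define N where "N = j + nat \<bar>k\<bar>"
  define M where "M = nat (int N + k)"
  have M: "int M = int N + k" "j \<le> M"
    by (auto simp: M_def N_def)
  have "real n ^ M = real n ^ N * real n powi k"
    using M(1) n by (metis power_int_add power_int_of_nat of_nat_0_eq_iff not_numeral_le_zero)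
  then have "real n ^ M * seq_value n x - real n ^ N * seq_value n y = real n ^ M * r"
    using n by (simp add: val algebra_simps)
  then have "seq_point n (suffix M x) = seq_point n (suffix N y)"
    using Ints_power_mult_mono[OF j M(2)] xy sup by (intro seq_point_suffix_eqI) auto
  then have suf: "suffix M x = suffix N y"
    using inj_on_seq_point xy suffix_cantor_seqs by (metis inj_onD)
  have "0 \<le> int i + k \<and> x (nat (int i + k)) = y i" if "i \<ge> N" for i
  proof -
    have "nat (int i + k) = M + (i - N)"
      using that M by simp
    then show ?thesis
      using fun_cong[OF suf, of "i - N"] that M by simp
  qed
  then show ?thesis
    using xy by (auto simp: cuntz_groupoid_def)
qed

lemma cuntz_cocycle_fibre_iff:
  assumes "r \<in> nadic n"
  shows "(x, k, y) \<in> cuntz_groupoid n \<and> cuntz_cocycle n (x, k, y) = (r, k) \<longleftrightarrow>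
    y \<in> beta_dom n (r, k) \<and> x = beta n (r, k) y"
  unfolding beta_graph_iff
proof (intro iffI conjI; (elim conjE)?)
  assume g: "(x, k, y) \<in> cuntz_groupoid n" and c: "cuntz_cocycle n (x, k, y) = (r, k)"
  show "x \<in> cantor_seqs n" "y \<in> cantor_seqs n"
    using g by (auto simp: cuntz_groupoid_def)
  show "snd (seq_point n x) = snd (seq_point n y)"
    using g by (auto simp: cuntz_groupoid_iff snd_seq_point_conc)
  show "seq_value n x = seq_value n y / real n powi k + r"
    using c cuntz_cocycle_eq[OF g] by simp
next
  assume *: "x \<in> cantor_seqs n" "y \<in> cantor_seqs n" "snd (seq_point n x) = snd (seq_point n y)"
    and val: "seq_value n x = seq_value n y / real n powi k + r"
  show g: "(x, k, y) \<in> cuntz_groupoid n"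
    using groupoid_if_nadic_affine[OF *(1,2) assms *(3) val] .
  show "cuntz_cocycle n (x, k, y) = (r, k)"
    using cuntz_cocycle_eq[OF g] val by simp
qed

end

theorem mainTheorem3:
  fixes n :: nat
  assumes "n \<ge> 2"
  shows
    "(\<forall>g \<in> cuntz_groupoid n. \<exists>!c. cocycle_value n g c) \<and>
     cuntz_cocycle n \<in> cuntz_groupoid n \<rightarrow> carrier (nadic_group n) \<and>
     (\<forall>g \<in> cuntz_groupoid n. \<exists>U. openin (cuntz_topology n) U \<and> g \<in> U \<and>
        cuntz_cocycle n constant_on U) \<and>
     (\<forall>x k y l w. (x, k, y) \<in> cuntz_groupoid n \<longrightarrow> (y, l, w) \<in> cuntz_groupoid n \<longrightarrow>
        cuntz_cocycle n (x, k, y) \<otimes>\<^bsub>nadic_group n\<^esub> cuntz_cocycle n (y, l, w) =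
        cuntz_cocycle n (x, k + l, w)) \<and>
     (\<forall>r k. (r, k) \<in> carrier (nadic_group n) \<longrightarrow>
        {g \<in> cuntz_groupoid n. cuntz_cocycle n g = (r, k)} =
        {(x, k, y) | x y. y \<in> beta_dom n (r, k) \<and> x = beta n (r, k) y})"
proof (intro conjI)
  have n: "n > 0"
    using assms by simp
  show "\<forall>g\<in>cuntz_groupoid n. \<exists>!c. cocycle_value n g c"
    using cocycle_value_iff[OF assms] by auto
  show "cuntz_cocycle n \<in> cuntz_groupoid n \<rightarrow> carrier (nadic_group n)"
  proof
    fix g assume "g \<in> cuntz_groupoid n"
    then obtain u v where uv: "u \<in> lists {..<n}" "v \<in> lists {..<n}" "g \<in> cylinder n u v"
      using groupoid_cylinder[OF assms] by blast
    have "word_sum n u + - (word_sum n v / real n powi (int (length u) - int (length v))) \<in> nadic n"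
      by (intro nadic_add nadic_uminus nadic_divide_powi word_sum_nadic n)
    then show "cuntz_cocycle n g \<in> carrier (nadic_group n)"
      by (simp add: cuntz_cocycle_cylinder[OF assms uv] nadic_group_def)
  qed
  show "\<forall>g\<in>cuntz_groupoid n. \<exists>U. openin (cuntz_topology n) U \<and> g \<in> U \<and>
      cuntz_cocycle n constant_on U"
  proof
    fix g assume "g \<in> cuntz_groupoid n"
    then obtain u v where uv: "u \<in> lists {..<n}" "v \<in> lists {..<n}" "g \<in> cylinder n u v"
      using groupoid_cylinder[OF assms] by blast
    have "openin (cuntz_topology n) (cylinder n u v)"
      unfolding cuntz_topology_def using uv by (intro topology_generated_by_Basis) auto
    moreover have "cuntz_cocycle n constant_on cylinder n u v"
      using cuntz_cocycle_cylinder[OF assms uv(1,2)] by (auto simp: constant_on_def)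
    ultimately show "\<exists>U. openin (cuntz_topology n) U \<and> g \<in> U \<and> cuntz_cocycle n constant_on U"
      using uv(3) by blast
  qed
  show "\<forall>x k y l w. (x, k, y) \<in> cuntz_groupoid n \<longrightarrow> (y, l, w) \<in> cuntz_groupoid n \<longrightarrow>
      cuntz_cocycle n (x, k, y) \<otimes>\<^bsub>nadic_group n\<^esub> cuntz_cocycle n (y, l, w) =
      cuntz_cocycle n (x, k + l, w)"
  proof (intro allI impI)
    fix x k y l w
    assume g: "(x, k, y) \<in> cuntz_groupoid n" and h: "(y, l, w) \<in> cuntz_groupoid n"
    have "seq_value n w / real n powi (k + l) = seq_value n w / real n powi l / real n powi k"
      using n by (simp add: power_int_add mult.commute)
    then show "cuntz_cocycle n (x, k, y) \<otimes>\<^bsub>nadic_group n\<^esub> cuntz_cocycle n (y, l, w) =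
        cuntz_cocycle n (x, k + l, w)"
      by (simp add: cuntz_cocycle_eq[OF assms g] cuntz_cocycle_eq[OF assms h]
          cuntz_cocycle_eq[OF assms cuntz_groupoid_mult[OF assms g h]] nadic_group_def
          diff_divide_distrib del: divide_divide_eq_left)
  qed
  show "\<forall>r k. (r, k) \<in> carrier (nadic_group n) \<longrightarrow>
      {g \<in> cuntz_groupoid n. cuntz_cocycle n g = (r, k)} =
      {(x, k, y) | x y. y \<in> beta_dom n (r, k) \<and> x = beta n (r, k) y}"
  proof (intro allI impI)
    fix r k assume "(r, k) \<in> carrier (nadic_group n)"
    then have r: "r \<in> nadic n"
      by (simp add: nadic_group_def)
    have "snd (cuntz_cocycle n (x, l, y)) = l" if "(x, l, y) \<in> cuntz_groupoid n" for x l y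
      using cuntz_cocycle_eq[OF assms that] by simp
    then have "{g \<in> cuntz_groupoid n. cuntz_cocycle n g = (r, k)} =
        {(x, k, y) | x y. (x, k, y) \<in> cuntz_groupoid n \<and> cuntz_cocycle n (x, k, y) = (r, k)}"
      by force
    then show "{g \<in> cuntz_groupoid n. cuntz_cocycle n g = (r, k)} =
        {(x, k, y) | x y. y \<in> beta_dom n (r, k) \<and> x = beta n (r, k) y}"
      unfolding cuntz_cocycle_fibre_iff[OF assms r] .
  qed
qed

end
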